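(* Let $K$ be a quadratic field and $c \in K$. Then the directed graph $G(f_c,K)$ does not contain a subgraph isomorphic to the graph $G_5$.
   Context: For $f_c(z) = z^2 + c$ and a number field $K$, $G(f_c,K)$ is the directed graph whose vertices are the points of $K$ (the point at infinity excluded) that are preperiodic for $f_c$, with an edge $x \to y$ iff $f_c(x) = y$. The graph $G_5$ has twelve vertices $p, q, \bar p, \bar q, a, a', b, b', s, \bar s, r, \bar r$ and edges $p \to q$, $q \to p$, $\bar p \to q$, $\bar q \to p$, $a \to a$, $b \to a$, $a' \to a'$, $b' \to a'$, $s \to b$, $\bar s \to b$, $r \to b'$, $\bar r \to b'$ (equivalently: a $2$-cycle, two distinct fixed points, and two points $s, r$ of preperiodic type $1_2$ with $f_c(s) \neq f_c(r)$, together with the preimages these force). *)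

theory Defs
  imports Complex_Main "Graph_Theory.Graph_Theory"
begin

text \<open>
  Every field of characteristic zero is a vector space over the rationals; a quadratic field
  is one of dimension 2. As \<^const>\<open>vector_space.dim\<close> returns 0 for infinite-dimensional spaces,
  the value 2 says that there is a basis with exactly two elements.
\<close>

definition rat_scale :: "rat \<Rightarrow> 'k::field_char_0 \<Rightarrow> 'k" where
  "rat_scale r x = of_rat r * x"

interpretation rat_space: vector_space "rat_scale :: rat \<Rightarrow> 'k::field_char_0 \<Rightarrow> 'k"
  by unfold_locales (simp_all add: rat_scale_def of_rat_add of_rat_mult algebra_simps)

definition quadratic_field :: "'k::field_char_0 itself \<Rightarrow> bool" where
  "quadratic_field K \<longleftrightarrow> vector_space.dim (rat_scale :: rat \<Rightarrow> 'k \<Rightarrow> 'k) UNIV = 2"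

definition quad_map :: "'k::field \<Rightarrow> 'k \<Rightarrow> 'k" where
  "quad_map c z = z ^ 2 + c"

definition preperiodic :: "('a \<Rightarrow> 'a) \<Rightarrow> 'a \<Rightarrow> bool" where
  "preperiodic f x \<longleftrightarrow> (\<exists>m n. n > 0 \<and> (f ^^ (m + n)) x = (f ^^ m) x)"

definition preperiodic_graph :: "('a \<Rightarrow> 'a) \<Rightarrow> 'a pair_pre_digraph" where
  "preperiodic_graph f =
     \<lparr> pverts = {x. preperiodic f x}, parcs = {(x, f x) | x. preperiodic f x} \<rparr>"

datatype G5_vertex =
  V_p | V_q | V_pbar | V_qbar | V_a | V_a' | V_b | V_b' | V_s | V_sbar | V_r | V_rbar

definition G5 :: "G5_vertex pair_pre_digraph" where
  "G5 = \<lparr> pverts = {V_p, V_q, V_pbar, V_qbar, V_a, V_a', V_b, V_b', V_s, V_sbar, V_r, V_rbar},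
          parcs = {(V_p, V_q), (V_q, V_p), (V_pbar, V_q), (V_qbar, V_p),
                   (V_a, V_a), (V_b, V_a), (V_a', V_a'), (V_b', V_a'),
                   (V_s, V_b), (V_sbar, V_b), (V_r, V_b'), (V_rbar, V_b')} \<rparr>"

text \<open>
  The subgraph relation of the library is a conjunction that includes well-formedness of both graphs,
  and isomorphism includes it for its first argument. The next two facts show that these
  side conditions hold for the graphs at hand, so that negating the containment below is
  not vacuously true. Subgraphs are not required to be induced.
\<close>

lemma wf_preperiodic_graph: "wf_digraph (with_proj (preperiodic_graph f))"
proof -
  have "preperiodic f (f x)" if px: "preperiodic f x" for x
  proof -
    obtain m n where n: "n > 0" and eq: "(f ^^ (m + n)) x = (f ^^ m) x"
      using px by (auto simp: preperiodic_def)
    have "(f ^^ (m + n)) (f x) = f ((f ^^ (m + n)) x)" by (rule funpow_swap1 [symmetric])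
    also have "\<dots> = (f ^^ m) (f x)" by (simp only: eq funpow_swap1)
    finally show ?thesis using n by (auto simp: preperiodic_def)
  qed
  then show ?thesis
    by unfold_locales (auto simp: preperiodic_graph_def)
qed

lemma wf_G5: "wf_digraph (with_proj G5)"
  by unfold_locales (auto simp: G5_def)

definition contains_subgraph_iso :: "'a pair_pre_digraph \<Rightarrow> 'b pair_pre_digraph \<Rightarrow> bool" where
  "contains_subgraph_iso G P \<longleftrightarrow>
     (\<exists>H. subgraph H (with_proj G) \<and> digraph_iso (with_proj P) H)"

end

theory Submission
  imports Defs "HOL-Computational_Algebra.Nth_Powers"
begin

text \<open>
  Let $x$ be the difference of the two fixed points, so $c = (1 - x^2)/4$. The 2-cycle and the points
  $s$, $r$ give $y_1 = p - q$, $y_2 = 2s$, $y_3 = 2r$ in $K$ with $y_1^2 = x^2 - 4$,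
  $y_2^2 = (x-3)(x+1)$, $y_3^2 = (x+3)(x-1)$, a curve of genus 5. Multiplying two of these equations
  gives three genus 1 quotients of rank 0; their rational points are found from the identities
  $f + b^2 = \Box$, $f + N^2 b^2 = \Box$ with $N \in \{2, 4\}$, which Fermat descent
  shows to be possible only trivially.

  If $x$ is rational, two of the $y_i$ have a rational product and $x$ is a rational point of a quotient.
  Otherwise let $x$ have trace $t$ and norm $n$ over the rationals. On each quotient $y^2 = f(x)$
  the conjugate pair lies on a parabola $y = X^2 + \beta X + \alpha$ that meets the curve in one further point,
  which is rational. As there are finitely many of those, $(t, n)$ lies on one of
  finitely many lines and conics for each quotient. Intersecting these, and using that the norms of
  the $y_i^2$ are squares, leaves only $x^2 = -7/2$, where $x^2 - 4$ is not a square in $K$.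
\<close>

section \<open>Concordant forms\<close>

lemma coprime_product_square:
  fixes m k w :: nat
  assumes "coprime m k" "m * k = w\<^sup>2" "w > 0"
  obtains u v where "m = u\<^sup>2" "k = v\<^sup>2" "w = u * v"
proof -
  have "m > 0" "k > 0" using assms(2,3) by (auto intro: gr0I)
  moreover have "is_nth_power 2 (m * k)" using assms(2) by auto
  ultimately have "is_nth_power 2 m" "is_nth_power 2 k"
    using is_nth_power_mult_coprime_natD[OF assms(1)] by blast+
  then obtain u v where uv: "m = u\<^sup>2" "k = v\<^sup>2" by (auto elim!: is_nth_powerE)
  then have "w\<^sup>2 = (u * v)\<^sup>2" using assms by (simp add: power_mult_distrib)
  then have "w = u * v" by simp
  with uv that show thesis by blast
qed

lemma odd_square_mod_8: "odd (n::nat) \<Longrightarrow> n\<^sup>2 mod 8 = 1"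
proof -
  assume "odd n"
  then have "n mod 8 \<in> {1,3,5,7}" by (simp add: odd_iff_mod_2_eq_one) presburger
  then have "(n mod 8)\<^sup>2 mod 8 = 1" by auto
  then show ?thesis by (simp add: power_mod)
qed

lemma pythagorean_leg_even:
  fixes a b c :: nat
  assumes "odd a" "a\<^sup>2 + b\<^sup>2 = c\<^sup>2"
  shows "even b"
proof (rule ccontr)
  assume "odd b"
  then have "a\<^sup>2 mod 8 = 1" "b\<^sup>2 mod 8 = 1" using odd_square_mod_8 assms(1) by blast+
  then obtain i j where ij: "a\<^sup>2 = 1 + 8 * i" "b\<^sup>2 = 1 + 8 * j"
    by (metis mod_mult_div_eq)
  have "even c" using \<open>odd b\<close> assms by (metis even_add even_power)
  then obtain e where "c = 2 * e" by blast
  then have "1 + 4 * i + 4 * j = 2 * e\<^sup>2" using assms(2) ij by (simp add: power_mult_distrib)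
  moreover have "odd (1 + 4 * i + 4 * j)" by simp
  ultimately show False by simp
qed

text \<open>Writing \<open>c = a + 2 * k\<close> turns the equation into
  \<open>(a + k) * k = w^2\<close> with coprime factors, so both are squares, \<open>u^2\<close> and
  \<open>v^2\<close>. The difference of squares is stated as a sum to avoid truncated
  subtraction.\<close>

lemma pythagorean_parametrisation:
  fixes a b c :: nat
  assumes "coprime a b" "odd a" "b > 0" "a\<^sup>2 + b\<^sup>2 = c\<^sup>2"
  obtains u v where "a + v\<^sup>2 = u\<^sup>2" "b = 2 * u * v" "coprime u v"
proof -
  obtain w where w: "b = 2 * w" using pythagorean_leg_even assms by blast
  have "odd c" using assms w by (metis even_add even_power even_mult_iff dvd_triv_left pos2)
  have "a \<le> c" using assms(4) by (metis le_add1 power2_nat_le_eq_le)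
  then obtain k where k: "c = a + 2 * k" using \<open>odd a\<close> \<open>odd c\<close>
    by (metis add_diff_inverse_nat even_diff_nat evenE linorder_not_le odd_add)
  define m where "m = a + k"
  have "4 * (m * k) = 4 * w\<^sup>2"
    using assms(4) unfolding k w m_def by (simp add: power2_eq_square algebra_simps)
  then have mk: "m * k = w\<^sup>2" by simp
  have "coprime a (m * k)" using assms(1) unfolding mk w by simp
  have "coprime m k"
  proof (rule coprimeI)
    fix d assume "d dvd m" "d dvd k"
    then have "d dvd a" "d dvd m * k" using m_def by (auto simp: dvd_add_left_iff)
    then show "is_unit d" using \<open>coprime a (m * k)\<close> by (meson coprime_common_divisor)
  qed
  moreover have "w > 0" using assms(3) w by simp
  ultimately obtain u v where uv: "m = u\<^sup>2" "k = v\<^sup>2" "w = u * v"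
    using coprime_product_square[OF _ mk] by blast
  show thesis
  proof (rule that)
    show "a + v\<^sup>2 = u\<^sup>2" using uv m_def by simp
    show "b = 2 * u * v" using uv w by simp
    show "coprime u v" using \<open>coprime m k\<close> uv by simp
  qed
qed

text \<open>Dividing \<open>u\<close> and \<open>w\<close> by their gcd \<open>p\<close> leaves
  coprime cofactors, so \<open>q\<close> divides \<open>z\<close>. The descent uses this to refine
  two factorisations of one number into common pieces.\<close>

lemma four_numbers:
  fixes u v w z :: nat
  assumes "u * v = w * z" "u > 0"
  obtains p q r s where "u = p * q" "w = p * r" "v = r * s" "z = q * s" "coprime q r"
proof -
  define p where "p = gcd u w"
  have "p > 0" using assms p_def by simp
  obtain q r where qr: "u = p * q" "w = p * r" "coprime q r"
    using assms(2) unfolding p_def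
    by (metis gcd_coprime_exists gcd_eq_0_iff less_numeral_extra(3) mult.commute)
  have eq: "q * v = r * z" using assms(1) qr \<open>p > 0\<close> by simp
  then have "q dvd z" using \<open>coprime q r\<close> by (metis coprime_dvd_mult_right_iff dvd_triv_left)
  then obtain s where s: "z = q * s" by blast
  have "q > 0" using assms qr by (auto intro: gr0I)
  then have "v = r * s" using eq s by simp
  with qr s that show thesis by blast
qed

section \<open>Fermat descent\<close>

lemma three_dvd_sum_squares:
  fixes p s :: nat
  assumes "3 dvd p\<^sup>2 + s\<^sup>2"
  shows "3 dvd p \<and> 3 dvd s"
proof -
  have *: "n\<^sup>2 mod 3 = (if 3 dvd n then 0 else 1)" for n :: nat
  proof -
    have "n mod 3 \<in> {0,1,2}" by auto
    then show ?thesis by (auto simp: dvd_eq_mod_eq_0 power_mod[of n 3, symmetric])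
  qed
  have "(p\<^sup>2 mod 3 + s\<^sup>2 mod 3) mod 3 = 0" using assms by (simp add: mod_add_eq dvd_eq_mod_eq_0)
  then show ?thesis by (auto simp: * split: if_splits)
qed

text \<open>
  The two sums of squares in \<open>eq\<close> are $r^2$ and $q^2$ times a common factor dividing $N^2 - 1$,
  which congruences modulo 3 and 8 force to be 1.
\<close>

lemma concordant_step:
  fixes p q r s N :: nat
  assumes N: "N = 2 \<or> N = 4" and cop: "coprime p s" "coprime q r" and odd: "odd s" "odd q"
    and eq: "q\<^sup>2 * (p\<^sup>2 + s\<^sup>2) = r\<^sup>2 * (N\<^sup>2 * p\<^sup>2 + s\<^sup>2)"
  shows "s\<^sup>2 + p\<^sup>2 = r\<^sup>2 \<and> s\<^sup>2 + N\<^sup>2 * p\<^sup>2 = q\<^sup>2"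
proof -
  have "r\<^sup>2 dvd p\<^sup>2 + s\<^sup>2"
    using cop(2) by (metis coprime_commute coprime_dvd_mult_right_iff coprime_power_left_iff
        coprime_power_right_iff dvd_triv_left eq)
  then obtain k where k: "p\<^sup>2 + s\<^sup>2 = r\<^sup>2 * k" by blast
  have "p\<^sup>2 + s\<^sup>2 > 0" using odd by (auto intro: gr0I)
  then have "r > 0" using k by (auto intro: gr0I)
  then have k2: "N\<^sup>2 * p\<^sup>2 + s\<^sup>2 = q\<^sup>2 * k" using eq unfolding k by simp
  define M where "M = N\<^sup>2 - 1"
  have N2: "N\<^sup>2 = M + 1" "M = 3 \<or> M = 15" using N by (auto simp: M_def)
  \<comment> \<open>Eliminating \<open>s^2\<close> gives \<open>M p^2 = (q^2 - r^2) k\<close>;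
    eliminating \<open>p^2\<close> below gives \<open>M s^2 = (N^2 r^2 - q^2) k\<close>. Coprimality
    of \<open>p\<close> and \<open>s\<close> then leaves \<open>k dvd M\<close>.\<close>
  have "M * p\<^sup>2 + r\<^sup>2 * k = q\<^sup>2 * k" using k k2 N2 by (simp add: algebra_simps)
  then have d1: "k dvd M * p\<^sup>2" by (metis dvd_add_left_iff dvd_triv_right)
  have "M * s\<^sup>2 + q\<^sup>2 * k = N\<^sup>2 * (r\<^sup>2 * k)" unfolding k[symmetric] k2[symmetric] N2
    by (simp add: algebra_simps)
  then have d2: "k dvd M * s\<^sup>2" by (metis dvd_add_left_iff dvd_triv_right dvd_mult)
  have "k dvd gcd (M * p\<^sup>2) (M * s\<^sup>2)" using d1 d2 by simp
  also have "\<dots> = M" using cop(1) by (simp add: gcd_mult_distrib_nat [symmetric])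
  finally have kM: "k dvd M" .
  have "\<not> 3 dvd k"
  proof
    assume "3 dvd k"
    then have "3 dvd p\<^sup>2 + s\<^sup>2" unfolding k by (rule dvd_mult)
    then have "3 dvd p" "3 dvd s" using three_dvd_sum_squares by blast+
    then show False using coprime_common_divisor_nat[OF cop(1), of 3] by simp
  qed
  have "k \<noteq> 5"
  proof
    assume "k = 5"
    then have "M \<noteq> 3" using kM dvd_imp_le[of 5 3] by auto
    then have "M = 15" using N2(2) by blast
    then have "16 * p\<^sup>2 + s\<^sup>2 = 5 * q\<^sup>2" using k2 unfolding N2(1) \<open>k = 5\<close> by simp
    then have "s\<^sup>2 + 2 * p\<^sup>2 * 8 = 5 * q\<^sup>2" by simp
    then have "s\<^sup>2 mod 8 = 5 * q\<^sup>2 mod 8" by (metis mod_mult_self1)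
    also have "\<dots> = 5 * (q\<^sup>2 mod 8) mod 8" by (simp add: mod_mult_right_eq)
    finally show False using odd by (simp add: odd_square_mod_8)
  qed
  have "k = 1"
  proof -
    have "k dvd 15" using kM N2(2) by (auto intro: dvd_trans)
    then have "k dvd 3 * 5" by simp
    moreover have "coprime k 3"
      using \<open>\<not> 3 dvd k\<close> prime_imp_coprime[of 3 k] by (simp add: coprime_commute)
    ultimately have "k dvd 5" by (simp only: coprime_dvd_mult_right_iff)
    then have "k = 1 \<or> k = 5" using prime_nat_iff[of 5] by auto
    then show ?thesis using \<open>k \<noteq> 5\<close> by blast
  qed
  then show ?thesis using k k2 by simp
qed

lemma coprime_two_or_four:
  fixes n N :: nat
  assumes "N = 2 \<or> N = 4" "odd n"
  shows "coprime N n"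
proof -
  have 2: "coprime 2 n" using assms(2) by simp
  then have "coprime (2 * 2) n" unfolding coprime_mult_left_iff by blast
  then have "coprime 4 n" by simp
  with 2 show ?thesis using assms(1) by blast
qed

text \<open>Only \<open>N = 4\<close> needs an argument: the square of twice an odd number is 4
  modulo 8, so \<open>c^2\<close> would be 5 modulo 8, which is impossible for an odd
  square.\<close>

lemma four_dvd_even_leg:
  fixes a b c N :: nat
  assumes N: "N = 2 \<or> N = 4" and "even a" "odd b" "a\<^sup>2 + b\<^sup>2 = c\<^sup>2"
  shows "N dvd a"
proof (rule ccontr)
  assume nd: "\<not> N dvd a"
  then have "N = 4" using N \<open>even a\<close> by auto
  obtain e where e: "a = 2 * e" using \<open>even a\<close> by blast
  have "odd e" using nd e \<open>N = 4\<close> by auto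
  have "odd c" using assms(2-4) by (metis even_add even_power)
  have "(4 * e\<^sup>2) mod 8 = 4 * (e\<^sup>2 mod 8) mod 8" by (simp add: mod_mult_right_eq)
  then have "(4 * e\<^sup>2) mod 8 = 4" using \<open>odd e\<close> by (simp add: odd_square_mod_8)
  moreover have "4 * e\<^sup>2 + b\<^sup>2 = c\<^sup>2" using assms(4) unfolding e by (simp add: power_mult_distrib)
  then have "c\<^sup>2 mod 8 = ((4 * e\<^sup>2) mod 8 + b\<^sup>2 mod 8) mod 8" by (simp only: mod_add_eq)
  ultimately show False using \<open>odd e\<close> \<open>odd b\<close> \<open>odd c\<close> by (simp add: odd_square_mod_8)
qed

text \<open>Infinite descent on \<open>a * b\<close>: from a solution with nonzero product, a
  solution with smaller nonzero product is built. Common factors are removed first; then the parity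
  of \<open>a\<close> decides.\<close>

lemma concordant_forms:
  fixes a b c d N :: nat
  assumes N: "N = 2 \<or> N = 4"
    and "a\<^sup>2 + b\<^sup>2 = c\<^sup>2" "a\<^sup>2 + N\<^sup>2 * b\<^sup>2 = d\<^sup>2"
  shows "a * b = 0"
  using assms(2,3)
proof (induction "a * b" arbitrary: a b c d rule: less_induct)
  case less
  note ac = less.prems(1) and ad = less.prems(2)
  show ?case
  proof (rule ccontr)
    assume nz: "a * b \<noteq> 0"
    then have pos: "a > 0" "b > 0" by auto
    have smaller: False if "a'\<^sup>2 + b'\<^sup>2 = c'\<^sup>2" "a'\<^sup>2 + N\<^sup>2 * b'\<^sup>2 = d'\<^sup>2"
      "a' > 0" "b' > 0" "a' * b' < a * b" for a' b' c' d'
      using less.hyps[of a' b' c' d'] that by simp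
    have cop: "coprime a b"
    proof (rule ccontr)
      assume nc: "\<not> coprime a b"
      define g where "g = gcd a b"
      have "g > 0" using pos g_def by simp
      have "g \<noteq> 1" using nc g_def by (auto simp: coprime_iff_gcd_eq_1)
      with \<open>g > 0\<close> have "g > 1" by simp
      obtain a' b' where ab: "a = g * a'" "b = g * b'"
        unfolding g_def by (meson dvdE gcd_dvd1 gcd_dvd2)
      have "g\<^sup>2 * (a'\<^sup>2 + b'\<^sup>2) = c\<^sup>2" using ac ab by (simp add: power_mult_distrib algebra_simps)
      moreover have "g dvd c" using calculation by (metis dvd_triv_left pow_divides_pow_iff pos2)
      then obtain c' where "c = g * c'" by blast
      ultimately have 1: "a'\<^sup>2 + b'\<^sup>2 = c'\<^sup>2" using \<open>g > 0\<close> by (simp add: power_mult_distrib)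
      have "g\<^sup>2 * (a'\<^sup>2 + N\<^sup>2 * b'\<^sup>2) = d\<^sup>2" using ad ab by (simp add: power_mult_distrib algebra_simps)
      moreover have "g dvd d" using calculation by (metis dvd_triv_left pow_divides_pow_iff pos2)
      then obtain d' where "d = g * d'" by blast
      ultimately have 2: "a'\<^sup>2 + N\<^sup>2 * b'\<^sup>2 = d'\<^sup>2" using \<open>g > 0\<close> by (simp add: power_mult_distrib)
      have p: "a' > 0" "b' > 0" using pos ab by auto
      have "a' < a" "b' \<le> b" using ab p \<open>g > 1\<close> by auto
      then have "a' * b' < a * b" using p by (simp add: mult_less_le_imp_less)
      then show False using smaller 1 2 p by blast
    qed
    show False
    proof (cases "even a")
      case True
      then have "odd b" using cop by (metis coprime_common_divisor_nat numeral_eq_one_iff semiring_norm(85))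
      \<comment> \<open>With \<open>a = N * e\<close> the two equations swap roles: the second,
        divided by \<open>N^2\<close>, starts with \<open>b^2 + e^2\<close>, and the first becomes
        \<open>b^2 + N^2 e^2 = c^2\<close>.\<close>
      then obtain e where e: "a = N * e"
        using four_dvd_even_leg[OF N True _ ac] by blast
      have "N > 0" using N by auto
      have "N\<^sup>2 * (b\<^sup>2 + e\<^sup>2) = d\<^sup>2" using ad e by (simp add: power_mult_distrib algebra_simps)
      moreover have "N dvd d" using calculation by (metis dvd_triv_left pow_divides_pow_iff pos2)
      then obtain d' where "d = N * d'" by blast
      ultimately have 1: "b\<^sup>2 + e\<^sup>2 = d'\<^sup>2" using \<open>N > 0\<close> by (simp add: power_mult_distrib)
      have 2: "b\<^sup>2 + N\<^sup>2 * e\<^sup>2 = c\<^sup>2" using ac e by (simp add: power_mult_distrib)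
      have "e > 0" using pos e by auto
      moreover have "e < a" using e N \<open>e > 0\<close> by auto
      ultimately show False using smaller[OF 1 2] pos by simp
    next
      case False
      have copN: "coprime a (N * b)" using cop False N
        by (simp add: coprime_two_or_four coprime_commute)
      \<comment> \<open>\<open>a\<close> is the odd leg of two primitive triples with even legs
        \<open>b\<close> and \<open>N * b\<close>. Comparing their parametrisations gives the
        relations \<open>prod\<close> and \<open>sum\<close> below.\<close>
      obtain u v where uv: "a + v\<^sup>2 = u\<^sup>2" "b = 2 * u * v" "coprime u v"
        using pythagorean_parametrisation[OF cop False pos(2) ac] by blast
      obtain U V where UV: "a + V\<^sup>2 = U\<^sup>2" "N * b = 2 * U * V" "coprime U V"
      proof (rule pythagorean_parametrisation[OF copN False])
        show "N * b > 0" using pos N by auto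
        show "a\<^sup>2 + (N * b)\<^sup>2 = d\<^sup>2" using ad by (simp add: power_mult_distrib)
      qed
      have prod: "N * (u * v) = U * V" using UV(2) uv(2) by simp
      have "2 * U * V > 0" unfolding UV(2)[symmetric] using pos N by auto
      then have pos': "u > 0" "v > 0" "U > 0" "V > 0" using pos uv(2) by auto
      have sum: "u\<^sup>2 + V\<^sup>2 = U\<^sup>2 + v\<^sup>2" using uv(1) UV(1) by simp
      have small: "p * s < a * b" if "u * v = (p * s) * k" "k > 0" for p s k
      proof -
        have "p * s \<le> u * v" using that by simp
        also have "\<dots> < b" using uv(2) pos' by simp
        also have "\<dots> \<le> a * b" using pos by simp
        finally show ?thesis .
      qed
      have parity: "odd U = even V" using UV(1) False by (metis even_add even_power pos2)
      show False
      proof (cases "even U")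
        case True
        then have "odd V" using parity by simp
        then have "coprime N V" using coprime_two_or_four[OF N] by blast
        then have "N dvd U" using prod by (metis coprime_dvd_mult_left_iff dvd_triv_left)
        then obtain U' where U': "U = N * U'" by blast
        have "u * v = U' * V" using prod N unfolding U' by auto
        \<comment> \<open>In these factors \<open>sum\<close> reads
          \<open>q^2 (p^2 + s^2) = r^2 (N^2 p^2 + s^2)\<close>, so \<open>concordant_step\<close>
          makes \<open>s\<close>, \<open>p\<close> a new solution. It is smaller because
          \<open>s * p\<close> divides \<open>u * v\<close>, and
          \<open>b = 2 * u * v\<close>.\<close>
        then obtain p q r s where f: "u = p * q" "U' = p * r" "v = r * s" "V = q * s" "coprime q r"
          using four_numbers pos'(1) by blast
        have "coprime p s" using uv(3) f by simp
        moreover have "odd s" "odd q" using \<open>odd V\<close> f by auto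
        moreover have "q\<^sup>2 * (p\<^sup>2 + s\<^sup>2) = r\<^sup>2 * (N\<^sup>2 * p\<^sup>2 + s\<^sup>2)"
          using sum unfolding U' f by (simp add: power_mult_distrib algebra_simps)
        ultimately have "s\<^sup>2 + p\<^sup>2 = r\<^sup>2 \<and> s\<^sup>2 + N\<^sup>2 * p\<^sup>2 = q\<^sup>2"
          using concordant_step[OF N] f(5) by blast
        moreover have "s * p < a * b" using small[of s p "q * r"] f pos' by (simp add: ac_simps)
        ultimately show False using smaller f pos' by auto
      next
        case odd: False
        then have "coprime N U" using coprime_two_or_four[OF N] by blast
        then have "N dvd V" using prod by (metis coprime_dvd_mult_right_iff dvd_triv_left)
        then obtain V' where V': "V = N * V'" by blast
        have "u * v = U * V'" using prod N unfolding V' by auto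
        \<comment> \<open>Here the factor \<open>N\<close> lies in \<open>V\<close> instead of
          \<open>U\<close>, which exchanges \<open>p\<close> with \<open>s\<close> and
          \<open>q\<close> with \<open>r\<close>.\<close>
        then obtain p q r s where f: "u = p * q" "U = p * r" "v = r * s" "V' = q * s" "coprime q r"
          using four_numbers pos'(1) by blast
        have "coprime s p" using uv(3) f by (simp add: coprime_commute)
        moreover have "odd p" "odd r" using odd f by auto
        moreover have "r\<^sup>2 * (s\<^sup>2 + p\<^sup>2) = q\<^sup>2 * (N\<^sup>2 * s\<^sup>2 + p\<^sup>2)"
          using sum unfolding V' f by (simp add: power_mult_distrib algebra_simps)
        ultimately have "p\<^sup>2 + s\<^sup>2 = q\<^sup>2 \<and> p\<^sup>2 + N\<^sup>2 * s\<^sup>2 = r\<^sup>2"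
          using concordant_step[OF N] f(5) by (metis coprime_commute)
        moreover have "p * s < a * b" using small[of p s "q * r"] f pos' by (simp add: ac_simps)
        ultimately show False using smaller f pos' by auto
      qed
    qed
  qed
qed

section \<open>Concordant forms over the rationals and rational points of the quotients\<close>

lemma rat_multiple_nat:
  fixes q :: rat
  obtains k m :: nat where "k > 0" "of_nat k * \<bar>q\<bar> = of_nat m"
proof -
  obtain i j where ij: "quotient_of q = (i, j)" by (cases "quotient_of q")
  have "j > 0" using quotient_of_denom_pos[OF ij] .
  have "q = of_int i / of_int j" using quotient_of_div[OF ij] .
  then have "of_int j * \<bar>q\<bar> = of_int \<bar>i\<bar>" using \<open>j > 0\<close> by (simp add: abs_divide)
  then have "of_nat (nat j) * \<bar>q\<bar> = of_nat (nat \<bar>i\<bar>)" using \<open>j > 0\<close> by simp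
  with \<open>j > 0\<close> that[of "nat j" "nat \<bar>i\<bar>"] show thesis by simp
qed

lemma concordant_forms_rat:
  fixes a b c d :: rat and N :: nat
  assumes N: "N = 2 \<or> N = 4"
    and ac: "a\<^sup>2 + b\<^sup>2 = c\<^sup>2" and ad: "a\<^sup>2 + of_nat N ^ 2 * b\<^sup>2 = d\<^sup>2"
  shows "a = 0 \<or> b = 0"
proof -
  obtain ka ma where a: "ka > 0" "of_nat ka * \<bar>a\<bar> = of_nat ma" by (rule rat_multiple_nat)
  obtain kb mb where b: "kb > 0" "of_nat kb * \<bar>b\<bar> = of_nat mb" by (rule rat_multiple_nat)
  obtain kc mc where c: "kc > 0" "of_nat kc * \<bar>c\<bar> = of_nat mc" by (rule rat_multiple_nat)
  obtain kd md where d: "kd > 0" "of_nat kd * \<bar>d\<bar> = of_nat md" by (rule rat_multiple_nat)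
  define k where "k = ka * kb * kc * kd"
  have "k > 0" using a b c d by (simp add: k_def)
  \<comment> \<open>\<open>k\<close> is a common denominator. Absolute values suffice since only
    squares occur in the equations.\<close>
  have A: "of_nat (ma * kb * kc * kd) = of_nat k * \<bar>a\<bar>"
    and B: "of_nat (mb * ka * kc * kd) = of_nat k * \<bar>b\<bar>"
    and C: "of_nat (mc * ka * kb * kd) = of_nat k * \<bar>c\<bar>"
    and D: "of_nat (md * ka * kb * kc) = of_nat k * \<bar>d\<bar>"
    unfolding k_def by (simp_all flip: a(2) b(2) c(2) d(2))
  have "rat_of_nat ((ma * kb * kc * kd)\<^sup>2 + (mb * ka * kc * kd)\<^sup>2) = of_nat ((mc * ka * kb * kd)\<^sup>2)"
    unfolding of_nat_add of_nat_power A B C using ac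
    by (simp add: power_mult_distrib flip: distrib_left)
  moreover have "rat_of_nat ((ma * kb * kc * kd)\<^sup>2 + N\<^sup>2 * (mb * ka * kc * kd)\<^sup>2) = of_nat ((md * ka * kb * kc)\<^sup>2)"
    unfolding of_nat_add of_nat_power of_nat_mult[of "N\<^sup>2"] A B D using ad
    by (simp add: power_mult_distrib mult.left_commute[of _ "(rat_of_nat k)\<^sup>2"] flip: distrib_left)
  ultimately have "(ma * kb * kc * kd) * (mb * ka * kc * kd) = 0"
    using concordant_forms[OF N] of_nat_eq_iff by blast
  then have "rat_of_nat (ma * kb * kc * kd) * of_nat (mb * ka * kc * kd) = 0"
    by (metis of_nat_0 of_nat_mult)
  then show ?thesis unfolding A B using \<open>k > 0\<close> by simp
qed

lemma rational_points_1:
  fixes r y :: rat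
  assumes "y\<^sup>2 = (r\<^sup>2 - 4) * ((r - 3) * (r + 1))"
  shows "y = 0 \<or> r = 1/2"
proof -
  \<comment> \<open>The quartic is invariant under \<open>r -> 1 - r\<close>: with
    \<open>m = r^2 - r\<close> it is \<open>(m - 2) (m - 6)\<close>, while
    \<open>(r - 1/2)^2 = m + 1/4\<close>. Adding 1 or 16 times the latter completes the
    square.\<close>
  have "y\<^sup>2 + (r - 1/2)\<^sup>2 = (r\<^sup>2 - r - 7/2)\<^sup>2"
    "y\<^sup>2 + of_nat 4 ^ 2 * (r - 1/2)\<^sup>2 = (r\<^sup>2 - r + 4)\<^sup>2"
    unfolding assms by (simp_all add: field_simps power2_eq_square)
  from concordant_forms_rat[OF _ this] show ?thesis by auto
qed

lemma rational_points_3: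
  fixes r y :: rat
  assumes "y\<^sup>2 = ((r - 3) * (r + 1)) * ((r + 3) * (r - 1))"
  shows "y = 0 \<or> r = 0"
proof -
  \<comment> \<open>The same with the symmetry \<open>r -> - r\<close>: for \<open>m = r^2\<close>
    the quartic is \<open>m^2 - 10 m + 9\<close>, and adding \<open>4 m\<close> or
    \<open>16 m\<close> gives \<open>(m - 3)^2\<close> or \<open>(m + 3)^2\<close>.\<close>
  have "y\<^sup>2 + (2 * r)\<^sup>2 = (r\<^sup>2 - 3)\<^sup>2"
    "y\<^sup>2 + of_nat 2 ^ 2 * (2 * r)\<^sup>2 = (r\<^sup>2 + 3)\<^sup>2"
    unfolding assms by (simp_all add: field_simps power2_eq_square)
  from concordant_forms_rat[OF _ this] show ?thesis by auto
qed

section \<open>Conjugate pairs on the genus 1 quotients\<close>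

text \<open>
  The pair $(t, n)$ stands for $X^2 - tX + n$. The lines come from the 2-torsion (pairs exchanged
  by an involution of the $x$-line), the conics from the points of order 4. Curve 1 belongs to $y_1 y_2$ and
  curve 3 to $y_2 y_3$; the conditions for $y_1 y_3$ are those of curve 1 after $t \mapsto -t$.
\<close>

definition lines_1 :: "rat \<Rightarrow> rat \<Rightarrow> bool" where
  "lines_1 t n \<longleftrightarrow> t = 1 \<or> 2 * n - t + 8 = 0 \<or> 2 * n - t - 7 = 0"

definition conics_1 :: "rat \<Rightarrow> rat \<Rightarrow> bool" where
  "conics_1 t n \<longleftrightarrow> (9 - 3 * t + n) * (4 + 2 * t + n) = 25 \<or> (4 - 2 * t + n) * (1 + t + n) = - 9"

definition lines_3 :: "rat \<Rightarrow> rat \<Rightarrow> bool" where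
  "lines_3 t n \<longleftrightarrow> t = 0 \<or> n = 3 \<or> n = - 3"

definition conics_3 :: "rat \<Rightarrow> rat \<Rightarrow> bool" where
  "conics_3 t n \<longleftrightarrow> (9 - 3 * t + n) * (9 + 3 * t + n) = 72 \<or> (1 - t + n) * (1 + t + n) = - 8"

text \<open>Eliminates the parameter \<open>e\<close>: one factor is inversely proportional to it,
  the other proportional. This produces the conics.\<close>

lemma product_of_proportional:
  fixes e X Y :: "'a::field"
  assumes "e * X = c" "q * Y = p * e" "q \<noteq> 0"
  shows "X * Y = p * c / q"
proof -
  have "q * (X * Y) = X * (q * Y)" by (rule mult.left_commute)
  also have "\<dots> = p * c" unfolding assms(2) assms(1)[symmetric] by (simp add: mult_ac)
  finally show ?thesis using assms(3) by (simp add: field_simps)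
qed

text \<open>
  The two hypotheses compare coefficients in $(A + Bx)^2 = f(x)$ after reduction by $x^2 = tx - n$.
\<close>

lemma pairs_1:
  fixes t n A B :: rat
  assumes h1: "2 * A * B + B\<^sup>2 * t = (t^3 - 2 * t * n) - 2 * (t\<^sup>2 - n) - 7 * t + 8"
    and h0: "A\<^sup>2 - B\<^sup>2 * n = - (t\<^sup>2 - n) * n + 2 * t * n + 7 * n + 12"
  shows "lines_1 t n \<or> conics_1 t n"
proof -
  \<comment> \<open>Modulo \<open>X^2 - t X + n\<close>, the polynomial
    \<open>X^2 + \<beta> X + \<alpha>\<close> reduces to \<open>A + B X\<close>. The quartic minus
    its square is a cubic divisible by \<open>X^2 - t X + n\<close>, with quotient
    \<open>e X + g\<close>.\<close>
  define \<beta> where "\<beta> = B - t"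
  define \<alpha> where "\<alpha> = A + n"
  define e where "e = - 2 - 2 * \<beta>"
  define g where "g = - 7 - 2 * \<alpha> - \<beta>\<^sup>2 + e * t"
  have c1: "8 - 2 * \<alpha> * \<beta> = n * e - t * g"
    using h1 unfolding g_def e_def \<alpha>_def \<beta>_def by algebra
  have c0: "12 - \<alpha>\<^sup>2 = n * g"
    using h0 unfolding g_def e_def \<alpha>_def \<beta>_def by algebra
  have ident: "(r\<^sup>2 - 4) * ((r - 3) * (r + 1)) - (r\<^sup>2 + \<beta> * r + \<alpha>)\<^sup>2 = (r\<^sup>2 - t * r + n) * (e * r + g)" for r
    using c1 c0 g_def e_def by algebra
  show ?thesis
  proof (cases "e = 0")
    \<comment> \<open>When \<open>e = 0\<close> the further intersection point lies at infinity,
      which yields the line \<open>t = 1\<close>.\<close>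
    case True
    then have "\<beta> = - 1" by (simp add: e_def)
    then have "(t - 1) * (8 + 2 * \<alpha>) = 0" using c1 True g_def by algebra
    moreover have "8 + 2 * \<alpha> \<noteq> 0"
    proof
      assume "8 + 2 * \<alpha> = 0"
      then have "\<alpha> = - 4" by simp
      then show False using c0 True \<open>\<beta> = - 1\<close> by (simp add: g_def)
    qed
    ultimately show ?thesis by (simp add: lines_1_def)
  next
    case False
    \<comment> \<open>\<open>r\<close> is the abscissa of the further intersection point;
      \<open>et\<close> and \<open>en\<close> recover \<open>t\<close> and \<open>n\<close> from it
      and the parabola.\<close>
    define r where "r = - g / e"
    have g: "g = - e * r" using False by (simp add: r_def)
    have \<beta>: "2 * \<beta> = - 2 - e" by (simp add: e_def)
    have et: "e * t = - e * r + 7 + 2 * \<alpha> + \<beta>\<^sup>2" using g_def g by simp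
    have en: "e * n = 8 - 2 * \<alpha> * \<beta> - (e * t) * r" using c1 g by algebra
    have pt: "(r\<^sup>2 + \<beta> * r + \<alpha>)\<^sup>2 = (r\<^sup>2 - 4) * ((r - 3) * (r + 1))" using ident[of r] g by simp
    show ?thesis
    proof (cases "r = 1/2")
      case True
      \<comment> \<open>At \<open>r = 1/2\<close> the quartic equals \<open>225/16\<close>; the two
        signs of the ordinate give the two remaining lines.\<close>
      have "(r\<^sup>2 + \<beta> * r + \<alpha>)\<^sup>2 = (15/4)\<^sup>2"
        unfolding pt unfolding True by (simp add: power2_eq_square)
      then consider "\<alpha> = 7/2 - \<beta> / 2" | "\<alpha> = - 4 - \<beta> / 2" using True
        unfolding power2_eq_iff by (auto simp: power2_eq_square field_simps)
      then show ?thesis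
      proof cases
        case 1
        then have "e * (2 * n - t - 7) = 0" using et en \<beta> \<open>r = 1/2\<close> by algebra
        then show ?thesis using False by (simp add: lines_1_def)
      next
        case 2
        then have "e * (2 * n - t + 8) = 0" using et en \<beta> \<open>r = 1/2\<close> by algebra
        then show ?thesis using False by (simp add: lines_1_def)
      qed
    next
      case not_half: False
      then have y: "r\<^sup>2 + \<beta> * r + \<alpha> = 0" using rational_points_1[OF pt] by blast
      then have roots: "(r - 2) * (r + 2) * (r - 3) * (r + 1) = 0" using pt by algebra
      have \<alpha>: "\<alpha> = - r\<^sup>2 - \<beta> * r" using y by simp
      from roots consider "r = 2" | "r = - 2" | "r = 3" | "r = - 1" by force
      then show ?thesis
      proof cases
        case 1
        \<comment> \<open>At a root \<open>r\<close> of the quartic, the cubic divided by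
          \<open>X - r\<close> takes at \<open>r\<close> the value of the derivative of the quartic,
          here \<open>-12\<close>; this equals \<open>e (r^2 - t r + n)\<close>. Evaluating at the
          partner root \<open>1 - r\<close>, here \<open>-1\<close>, makes the minimal polynomial
          there proportional to \<open>e\<close>. The other roots work alike.\<close>
        have "e * (4 - 2 * t + n) = 4 * e - 2 * (e * t) + e * n" by algebra
        also have "\<dots> = - 12" unfolding en et unfolding \<alpha> 1 e_def by (simp add: algebra_simps power2_eq_square)
        finally have X: "e * (4 - 2 * t + n) = - 12" .
        have "e * (4 * (1 + t + n) - 3 * e) = 4 * (e + e * t + e * n) - 3 * (e * e)" by algebra
        then have "e * (4 * (1 + t + n) - 3 * e) = 0"
          unfolding en et unfolding \<alpha> 1 e_def by (simp add: algebra_simps power2_eq_square)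
        then have Y: "4 * (1 + t + n) = 3 * e" using False by simp
        have "(4 - 2 * t + n) * (1 + t + n) = - 9" using product_of_proportional[OF X Y] by simp
        then show ?thesis by (simp add: conics_1_def mult.commute)
      next
        case 2
        have "e * (4 + 2 * t + n) = 4 * e + 2 * (e * t) + e * n" by algebra
        also have "\<dots> = - 20" unfolding en et unfolding \<alpha> 2 e_def by (simp add: algebra_simps power2_eq_square)
        finally have X: "e * (4 + 2 * t + n) = - 20" .
        have "e * (4 * (9 - 3 * t + n) + 5 * e) = 4 * (9 * e - 3 * (e * t) + e * n) + 5 * (e * e)" by algebra
        then have "e * (4 * (9 - 3 * t + n) + 5 * e) = 0"
          unfolding en et unfolding \<alpha> 2 e_def by (simp add: algebra_simps power2_eq_square)
        then have Y: "4 * (9 - 3 * t + n) = -5 * e" using False by simp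
        have "(4 + 2 * t + n) * (9 - 3 * t + n) = 25" using product_of_proportional[OF X Y] by simp
        then show ?thesis by (simp add: conics_1_def mult.commute)
      next
        case 3
        have "e * (9 - 3 * t + n) = 9 * e - 3 * (e * t) + e * n" by algebra
        also have "\<dots> = 20" unfolding en et unfolding \<alpha> 3 e_def by (simp add: algebra_simps power2_eq_square)
        finally have X: "e * (9 - 3 * t + n) = 20" .
        have "e * (4 * (4 + 2 * t + n) - 5 * e) = 4 * (4 * e + 2 * (e * t) + e * n) - 5 * (e * e)" by algebra
        then have "e * (4 * (4 + 2 * t + n) - 5 * e) = 0"
          unfolding en et unfolding \<alpha> 3 e_def by (simp add: algebra_simps power2_eq_square)
        then have Y: "4 * (4 + 2 * t + n) = 5 * e" using False by simp
        have "(9 - 3 * t + n) * (4 + 2 * t + n) = 25" using product_of_proportional[OF X Y] by simp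
        then show ?thesis by (simp add: conics_1_def mult.commute)
      next
        case 4
        have "e * (1 + t + n) = e + e * t + e * n" by algebra
        also have "\<dots> = 12" unfolding en et unfolding \<alpha> 4 e_def by (simp add: algebra_simps power2_eq_square)
        finally have X: "e * (1 + t + n) = 12" .
        have "e * (4 * (4 - 2 * t + n) + 3 * e) = 4 * (4 * e - 2 * (e * t) + e * n) + 3 * (e * e)" by algebra
        then have "e * (4 * (4 - 2 * t + n) + 3 * e) = 0"
          unfolding en et unfolding \<alpha> 4 e_def by (simp add: algebra_simps power2_eq_square)
        then have Y: "4 * (4 - 2 * t + n) = -3 * e" using False by simp
        have "(1 + t + n) * (4 - 2 * t + n) = - 9" using product_of_proportional[OF X Y] by simp
        then show ?thesis by (simp add: conics_1_def mult.commute)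
      qed
    qed
  qed
qed

text \<open>The argument of \<open>pairs_1\<close> for the quartic \<open>X^4 - 10 X^2 + 9\<close>.
  Its symmetry is \<open>X -> - X\<close>, so each root is now paired with its negative, and the
  special abscissa is 0 instead of \<open>1/2\<close>.\<close>

lemma pairs_3:
  fixes t n A B :: rat
  assumes h1: "2 * A * B + B\<^sup>2 * t = (t^3 - 2 * t * n) - 10 * t"
    and h0: "A\<^sup>2 - B\<^sup>2 * n = - (t\<^sup>2 - n) * n + 10 * n + 9"
  shows "lines_3 t n \<or> conics_3 t n"
proof -
  define \<beta> where "\<beta> = B - t"
  define \<alpha> where "\<alpha> = A + n"
  define e where "e = - 2 * \<beta>"
  define g where "g = - 10 - 2 * \<alpha> - \<beta>\<^sup>2 + e * t"
  have c1: "- 2 * \<alpha> * \<beta> = n * e - t * g"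
    using h1 unfolding g_def e_def \<alpha>_def \<beta>_def by algebra
  have c0: "9 - \<alpha>\<^sup>2 = n * g"
    using h0 unfolding g_def e_def \<alpha>_def \<beta>_def by algebra
  have ident: "((r - 3) * (r + 1)) * ((r + 3) * (r - 1)) - (r\<^sup>2 + \<beta> * r + \<alpha>)\<^sup>2 = (r\<^sup>2 - t * r + n) * (e * r + g)" for r
    using c1 c0 g_def e_def by algebra
  show ?thesis
  proof (cases "e = 0")
    case True
    then have "\<beta> = 0" by (simp add: e_def)
    then have "t * (10 + 2 * \<alpha>) = 0" using c1 True g_def by algebra
    moreover have "10 + 2 * \<alpha> \<noteq> 0"
    proof
      assume "10 + 2 * \<alpha> = 0"
      then have "\<alpha> = - 5" by simp
      then show False using c0 True \<open>\<beta> = 0\<close> by (simp add: g_def)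
    qed
    ultimately show ?thesis by (simp add: lines_3_def)
  next
    case False
    define r where "r = - g / e"
    have g: "g = - e * r" using False by (simp add: r_def)
    have \<beta>: "2 * \<beta> = - e" by (simp add: e_def)
    have et: "e * t = - e * r + 10 + 2 * \<alpha> + \<beta>\<^sup>2" using g_def g by simp
    have en: "e * n = - 2 * \<alpha> * \<beta> - (e * t) * r" using c1 g by algebra
    have pt: "(r\<^sup>2 + \<beta> * r + \<alpha>)\<^sup>2 = ((r - 3) * (r + 1)) * ((r + 3) * (r - 1))" using ident[of r] g by simp
    show ?thesis
    proof (cases "r = 0")
      case True
      then have "(\<alpha> - 3) * (\<alpha> + 3) = 0" using pt by algebra
      moreover have "e * (n - \<alpha>) = 0" using en \<beta> True by algebra
      ultimately show ?thesis using False by (auto simp: lines_3_def)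
    next
      case nz: False
      then have y: "r\<^sup>2 + \<beta> * r + \<alpha> = 0" using rational_points_3[OF pt] by blast
      then have roots: "(r - 3) * (r + 3) * (r - 1) * (r + 1) = 0" using pt by algebra
      have \<alpha>: "\<alpha> = - r\<^sup>2 - \<beta> * r" using y by simp
      from roots consider "r = 3" | "r = - 3" | "r = 1" | "r = - 1" by force
      then show ?thesis
      proof cases
        case 1
        have "e * (9 - 3 * t + n) = 9 * e - 3 * (e * t) + e * n" by algebra
        also have "\<dots> = 48" unfolding en et unfolding \<alpha> 1 e_def by (simp add: algebra_simps power2_eq_square)
        finally have X: "e * (9 - 3 * t + n) = 48" .
        have "e * (2 * (9 + 3 * t + n) - 3 * e) = 2 * (9 * e + 3 * (e * t) + e * n) - 3 * (e * e)" by algebra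
        then have "e * (2 * (9 + 3 * t + n) - 3 * e) = 0"
          unfolding en et unfolding \<alpha> 1 e_def by (simp add: algebra_simps power2_eq_square)
        then have Y: "2 * (9 + 3 * t + n) = 3 * e" using False by simp
        have "(9 - 3 * t + n) * (9 + 3 * t + n) = 72" using product_of_proportional[OF X Y] by simp
        then show ?thesis by (simp add: conics_3_def mult.commute)
      next
        case 2
        have "e * (9 + 3 * t + n) = 9 * e + 3 * (e * t) + e * n" by algebra
        also have "\<dots> = - 48" unfolding en et unfolding \<alpha> 2 e_def by (simp add: algebra_simps power2_eq_square)
        finally have X: "e * (9 + 3 * t + n) = - 48" .
        have "e * (2 * (9 - 3 * t + n) + 3 * e) = 2 * (9 * e - 3 * (e * t) + e * n) + 3 * (e * e)" by algebra
        then have "e * (2 * (9 - 3 * t + n) + 3 * e) = 0"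
          unfolding en et unfolding \<alpha> 2 e_def by (simp add: algebra_simps power2_eq_square)
        then have Y: "2 * (9 - 3 * t + n) = -3 * e" using False by simp
        have "(9 + 3 * t + n) * (9 - 3 * t + n) = 72" using product_of_proportional[OF X Y] by simp
        then show ?thesis by (simp add: conics_3_def mult.commute)
      next
        case 3
        have "e * (1 - t + n) = e - e * t + e * n" by algebra
        also have "\<dots> = - 16" unfolding en et unfolding \<alpha> 3 e_def by (simp add: algebra_simps power2_eq_square)
        finally have X: "e * (1 - t + n) = - 16" .
        have "e * (2 * (1 + t + n) - 1 * e) = 2 * (e + e * t + e * n) - 1 * (e * e)" by algebra
        then have "e * (2 * (1 + t + n) - 1 * e) = 0"
          unfolding en et unfolding \<alpha> 3 e_def by (simp add: algebra_simps power2_eq_square)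
        then have Y: "2 * (1 + t + n) = 1 * e" using False by simp
        have "(1 - t + n) * (1 + t + n) = - 8" using product_of_proportional[OF X Y] by simp
        then show ?thesis by (simp add: conics_3_def mult.commute)
      next
        case 4
        have "e * (1 + t + n) = e + e * t + e * n" by algebra
        also have "\<dots> = 16" unfolding en et unfolding \<alpha> 4 e_def by (simp add: algebra_simps power2_eq_square)
        finally have X: "e * (1 + t + n) = 16" .
        have "e * (2 * (1 - t + n) + 1 * e) = 2 * (e - e * t + e * n) + 1 * (e * e)" by algebra
        then have "e * (2 * (1 - t + n) + 1 * e) = 0"
          unfolding en et unfolding \<alpha> 4 e_def by (simp add: algebra_simps power2_eq_square)
        then have Y: "2 * (1 - t + n) = -1 * e" using False by simp
        have "(1 + t + n) * (1 - t + n) = - 8" using product_of_proportional[OF X Y] by simp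
        then show ?thesis by (simp add: conics_3_def mult.commute)
      qed
    qed
  qed
qed

section \<open>Intersecting the lines and conics\<close>

text \<open>A rational whose square is an integer is itself an integer. Applied to discriminants
  after completing the square, this excludes intersections with irrational coordinates.\<close>

lemma rat_square_not_between:
  fixes r :: rat and j k :: int
  assumes "r\<^sup>2 = of_int k" "j\<^sup>2 < k" "k < (j + 1)\<^sup>2" "j \<ge> 0"
  shows False
proof -
  obtain i m where im: "quotient_of r = (i, m)" by (cases "quotient_of r")
  have m: "m > 0" and cop: "coprime i m" and r: "r = of_int i / of_int m"
    using quotient_of_denom_pos[OF im] quotient_of_coprime[OF im] quotient_of_div[OF im] .
  have "rat_of_int (i\<^sup>2) = of_int (k * m\<^sup>2)"
    using assms(1) m unfolding r by (simp add: power_divide field_simps)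
  then have eq: "i\<^sup>2 = k * m\<^sup>2" by (simp only: of_int_eq_iff)
  then have "m dvd i * i" by (simp add: power2_eq_square)
  moreover have "coprime m i" using cop by (simp add: coprime_commute)
  ultimately have "m dvd i" by (simp only: coprime_dvd_mult_right_iff)
  then have "is_unit m" using cop by (meson coprime_common_divisor dvd_refl)
  then have "k = \<bar>i\<bar>\<^sup>2" using eq m by simp
  then have "j < \<bar>i\<bar>" "\<bar>i\<bar> < j + 1" using assms(2-4) by (meson abs_ge_zero add_increasing2 power_less_imp_less_base zero_le_one)+
  then show False by simp
qed

text \<open>Substituting each line into each reflected conic leaves a quadratic in \<open>n\<close>;
  completing the square exposes its discriminant, which is negative, a nonsquare, or zero in the one
  tangential case.\<close>

lemma lines_1_conics_1:
  assumes "lines_1 t n" "conics_1 (- t) n"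
  shows "t = 1 \<and> n = - 3"
proof -
  from assms(2) consider (a) "(9 + 3 * t + n) * (4 - 2 * t + n) = 25" | (b) "(4 + 2 * t + n) * (1 - t + n) = - 9"
    unfolding conics_1_def by auto
  note conic = this
  from assms(1) consider "t = 1" | "t = 2 * n + 8" | "t = 2 * n - 7"
    unfolding lines_1_def by force
  then show ?thesis
  proof cases
    case 1
    from conic show ?thesis
    proof cases
      case a
      then have "(n + 7)\<^sup>2 = of_int 50" unfolding 1 by (simp add: power2_eq_square algebra_simps)
      from rat_square_not_between[OF this, of 7] show ?thesis by simp
    next
      case b
      then have "(n + 3)\<^sup>2 = 0" unfolding 1 by (simp add: power2_eq_square algebra_simps)
      then show ?thesis using 1 by simp
    qed
  next
    case 2
    from conic show ?thesis
    proof cases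
      case a
      then have "(42 * n + 183)\<^sup>2 = - 1875" unfolding 2 by (simp add: power2_eq_square algebra_simps)
      then show ?thesis using zero_le_power2[of "42 * n + 183"] by linarith
    next
      case b
      then have "(10 * n + 55)\<^sup>2 = of_int 405" unfolding 2 by (simp add: power2_eq_square algebra_simps)
      from rat_square_not_between[OF this, of 20] show ?thesis by simp
    qed
  next
    case 3
    from conic show ?thesis
    proof cases
      case a
      then have "(42 * n - 162)\<^sup>2 = of_int 6000" unfolding 3 by (simp add: power2_eq_square algebra_simps)
      from rat_square_not_between[OF this, of 77] show ?thesis by simp
    next
      case b
      then have "(10 * n - 50)\<^sup>2 = of_int 1080" unfolding 3 by (simp add: power2_eq_square algebra_simps)
      from rat_square_not_between[OF this, of 32] show ?thesis by simp
    qed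
  qed
qed

text \<open>Each of the three lines meets each of their reflections under \<open>t -> - t\<close>
  once, except for the parallels \<open>t = 1\<close> and \<open>t = - 1\<close>; this leaves eight
  points.\<close>

lemma lines_1_lines_1:
  assumes "lines_1 t n" "lines_1 (- t) n"
  shows "(t, n) \<in> {(1, - 9/2), (1, 3), (- 1, - 9/2), (0, - 4), (15/2, - 1/4), (- 1, 3), (- 15/2, - 1/4), (0, 7/2)}"
proof -
  from assms(1) consider "t = 1" | "t = 2 * n + 8" | "t = 2 * n - 7"
    unfolding lines_1_def by force
  then show ?thesis
  proof cases
    case 1
    then have "2 * n = - 9 \<or> 2 * n = 6" using assms(2) unfolding lines_1_def by force
    then have "n = - 9/2 \<or> n = 3" by force
    then show ?thesis unfolding 1 by (elim disjE; simp only:; simp)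
  next
    case 2
    then have "2 * n = - 9 \<or> 4 * n = - 16 \<or> 4 * n = - 1" using assms(2) unfolding lines_1_def by force
    then have "n = - 9/2 \<or> n = - 4 \<or> n = - 1/4" by force
    then show ?thesis unfolding 2 by (elim disjE; simp only:; simp)
  next
    case 3
    then have "2 * n = 6 \<or> 4 * n = - 1 \<or> 4 * n = 14" using assms(2) unfolding lines_1_def by force
    then have "n = 3 \<or> n = - 1/4 \<or> n = 7/2" by force
    then show ?thesis unfolding 3 by (elim disjE; simp only:; simp)
  qed
qed

text \<open>The lines of curve 3 are symmetric under \<open>t -> - t\<close>, but the only rational
  points they share with the conics of curve 1, \<open>(-1, -3)\<close> and
  \<open>(7/2, -3)\<close>, are not reflections of each other or of themselves.\<close>

lemma conics_1_lines_3:
  assumes "conics_1 t n" "conics_1 (- t) n" "lines_3 t n"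
  shows False
proof -
  have *: "(n = - 3 \<and> (t = - 1 \<or> t = 7/2))" if c: "conics_1 t n" and l: "lines_3 t n" for t
  proof -
    from c consider (a) "(9 - 3 * t + n) * (4 + 2 * t + n) = 25" | (b) "(4 - 2 * t + n) * (1 + t + n) = - 9"
      unfolding conics_1_def by auto
    note conic = this
    from l consider "t = 0" | "n = 3" | "n = - 3" unfolding lines_3_def by blast
    then show ?thesis
    proof cases
      case 1
      from conic show ?thesis
      proof cases
        case a
        then have "(2 * n + 13)\<^sup>2 = of_int 125" unfolding 1 by (simp add: power2_eq_square algebra_simps)
        from rat_square_not_between[OF this, of 11] show ?thesis by simp
      next
        case b
        then have "(2 * n + 5)\<^sup>2 = - 27" unfolding 1 by (simp add: power2_eq_square algebra_simps)
        then show ?thesis using zero_le_power2[of "2 * n + 5"] by linarith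
      qed
    next
      case 2
      from conic show ?thesis
      proof cases
        case a
        then have "(12 * t - 3)\<^sup>2 = of_int 1425" unfolding 2 by (simp add: power2_eq_square algebra_simps)
        from rat_square_not_between[OF this, of 37] show ?thesis by simp
      next
        case b
        then have "(4 * t + 1)\<^sup>2 = of_int 297" unfolding 2 by (simp add: power2_eq_square algebra_simps)
        from rat_square_not_between[OF this, of 17] show ?thesis by simp
      qed
    next
      case 3
      from conic show ?thesis
      proof cases
        case a
        then have "(12 * t - 9)\<^sup>2 = - 375" unfolding 3 by (simp add: power2_eq_square algebra_simps)
        then show ?thesis using zero_le_power2[of "12 * t - 9"] by linarith
      next
        case b
        then have "(t + 1) * (2 * t - 7) = 0" unfolding 3 by (simp add: algebra_simps)
        then show ?thesis using 3 by auto
      qed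
    qed
  qed
  have "lines_3 (- t) n" using assms(3) unfolding lines_3_def by simp
  then show False using *[OF assms(1,3)] *[OF assms(2)] by auto
qed

text \<open>Write \<open>m(r) = r^2 - r t + n\<close>. Together with the square norms, the conics of
  curve 1 make \<open>m(3) m(-2)\<close> and \<open>m(-3) m(2)\<close> squares up to sign. As
  \<open>m(2) m(-2)\<close> is a square, so is \<open>m(3) m(-3)\<close> up to sign, which
  contradicts the conics of curve 3.\<close>

lemma conics_1_conics_3:
  fixes a b c t n :: rat
  assumes a: "a\<^sup>2 = (4 - 2 * t + n) * (4 + 2 * t + n)"
    and b: "b\<^sup>2 = (9 - 3 * t + n) * (1 + t + n)"
    and c: "c\<^sup>2 = (9 + 3 * t + n) * (1 - t + n)"
    and nz: "a \<noteq> 0" "b \<noteq> 0" "c \<noteq> 0"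
    and "conics_1 t n" "conics_1 (- t) n" "conics_3 t n"
  shows False
proof -
  have 1: "\<exists>r. r\<^sup>2 = \<bar>(9 - 3 * t + n) * (4 + 2 * t + n)\<bar>"
    if a: "a\<^sup>2 = (4 - 2 * t + n) * (4 + 2 * t + n)" 
      and b: "b\<^sup>2 = (9 - 3 * t + n) * (1 + t + n)" and c: "conics_1 t n" for t b
    using c unfolding conics_1_def
  proof
    assume "(9 - 3 * t + n) * (4 + 2 * t + n) = 25"
    then have "5\<^sup>2 = \<bar>(9 - 3 * t + n) * (4 + 2 * t + n)\<bar>" by simp
    then show ?thesis by blast
  next
    assume "(4 - 2 * t + n) * (1 + t + n) = - 9"
    then have "(a * b)\<^sup>2 = - 9 * ((9 - 3 * t + n) * (4 + 2 * t + n))"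
      unfolding power_mult_distrib a b by algebra
    then have "(9 - 3 * t + n) * (4 + 2 * t + n) = - (a * b / 3)\<^sup>2" by (simp add: power_divide)
    then have "(a * b / 3)\<^sup>2 = \<bar>(9 - 3 * t + n) * (4 + 2 * t + n)\<bar>" by simp
    then show ?thesis by blast
  qed
  obtain r where r: "r\<^sup>2 = \<bar>(9 - 3 * t + n) * (4 + 2 * t + n)\<bar>" using 1[of t b] assms by blast
  obtain s where s: "s\<^sup>2 = \<bar>(9 + 3 * t + n) * (4 - 2 * t + n)\<bar>"
    using 1[of "- t" c] assms by (auto simp: mult.commute)
  have "(r * s)\<^sup>2 = \<bar>a\<^sup>2 * ((9 - 3 * t + n) * (9 + 3 * t + n))\<bar>"
    unfolding power_mult_distrib r s a by (simp add: abs_mult mult_ac)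
  then have X: "(r * s / a)\<^sup>2 = \<bar>(9 - 3 * t + n) * (9 + 3 * t + n)\<bar>"
    using nz(1) by (simp add: power_divide abs_mult)
  from assms(9) consider "(9 - 3 * t + n) * (9 + 3 * t + n) = 72" | "(1 - t + n) * (1 + t + n) = - 8"
    unfolding conics_3_def by blast
  then show False
  proof cases
    case 1
    then show False using X rat_square_not_between[of "r * s / a" 72 8] by simp
  next
    case 2
    \<comment> \<open>Here \<open>m(1) m(-1) = -8\<close>, and
      \<open>b^2 c^2 = m(3) m(-3) m(1) m(-1)\<close> would make 8 a rational square.\<close>
    have "(b * c)\<^sup>2 = ((9 - 3 * t + n) * (9 + 3 * t + n)) * ((1 - t + n) * (1 + t + n))"
      unfolding power_mult_distrib b c by algebra
    then have "(b * c)\<^sup>2 = - 8 * ((9 - 3 * t + n) * (9 + 3 * t + n))" unfolding 2 by simp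
    then have "\<bar>(b * c)\<^sup>2\<bar> = \<bar>- 8 * ((9 - 3 * t + n) * (9 + 3 * t + n))\<bar>" by simp
    moreover define q where "q = r * s / a"
    ultimately have bc: "(b * c)\<^sup>2 = 8 * q\<^sup>2" using X by (simp add: abs_mult)
    then have "q \<noteq> 0" using nz by auto
    then have "(b * c / q)\<^sup>2 = of_int 8" using bc by (simp add: power_divide)
    from rat_square_not_between[OF this, of 2] show False by simp
  qed
qed

lemma trace_norm_unique:
  fixes a b c t n :: rat
  assumes a: "a\<^sup>2 = (4 - 2 * t + n) * (4 + 2 * t + n)"
    and b: "b\<^sup>2 = (9 - 3 * t + n) * (1 + t + n)"
    and c: "c\<^sup>2 = (9 + 3 * t + n) * (1 - t + n)"
    and nz: "a \<noteq> 0" "b \<noteq> 0" "c \<noteq> 0"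
    and 1: "lines_1 t n \<or> conics_1 t n" and 2: "lines_1 (- t) n \<or> conics_1 (- t) n"
    and 3: "lines_3 t n \<or> conics_3 t n"
  shows "t = 0 \<and> n = 7/2"
proof -
  have not45: "a\<^sup>2 \<noteq> 45" using rat_square_not_between[of a 45 6] by auto
  have neg: "a\<^sup>2 \<noteq> - 3" using zero_le_power2[of a] by linarith
  consider "lines_1 t n" "lines_1 (- t) n" | "lines_1 t n" "conics_1 (- t) n"
    | "conics_1 t n" "lines_1 (- t) n" | "conics_1 t n" "conics_1 (- t) n"
    using 1 2 by blast
  then show ?thesis
  proof cases
    case 1
    note pairs = lines_1_lines_1[OF this]
    have "n \<noteq> - 1/4"
    proof
      assume n: "n = - 1/4"
      then have "t = 15/2 \<or> t = - 15/2" using pairs by auto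
      then have "a\<^sup>2 = - 3375/16" unfolding a n by (elim disjE; simp only:; simp)
      then show False using zero_le_power2[of a] by linarith
    qed
    \<comment> \<open>Of the points left, \<open>(1, 3)\<close> and \<open>(-1, 3)\<close> give
      \<open>a^2 = 45\<close>, \<open>(0, -4)\<close> gives \<open>a = 0\<close>, and those with
      \<open>n = - 9/2\<close> miss all lines and conics of curve 3.\<close>
    then show ?thesis using pairs a not45 nz 3
      by (auto simp: lines_3_def conics_3_def)
  next
    case 2
    then have "t = 1 \<and> n = - 3" by (rule lines_1_conics_1)
    then show ?thesis using a neg by auto
  next
    case 3
    then have "- t = 1 \<and> n = - 3" using lines_1_conics_1[of "- t" n] by simp
    then show ?thesis using a neg by auto
  next
    case 4
    then show ?thesis using 3 conics_1_lines_3 conics_1_conics_3[OF a b c nz] by blast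
  qed
qed

section \<open>Points over a quadratic field\<close>

lemmas of_rat_hom = of_rat_add of_rat_diff of_rat_minus of_rat_mult of_rat_power

lemma linear_independence:
  fixes x :: "'k::field_char_0"
  assumes "x \<notin> \<rat>" "of_rat p + of_rat q * x = 0"
  shows "p = 0 \<and> q = 0"
proof -
  have "q = 0"
  proof (rule ccontr)
    assume "q \<noteq> 0"
    then have "x = - of_rat p / of_rat q" using assms(2) by (simp add: field_simps eq_neg_iff_add_eq_0)
    also have "\<dots> = of_rat (- p / q)" by (simp add: of_rat_minus of_rat_divide)
    finally show False using assms(1) by simp
  qed
  then show ?thesis using assms(2) by simp
qed

text \<open>The independent set \<open>{1, x}\<close> extends to a basis, which has two elements and
  so equals it. The nonzero cardinality also shows that this basis is finite.\<close>

lemma quadratic_field_coordinates: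
  fixes x y :: "'k::field_char_0"
  assumes "quadratic_field TYPE('k)" "x \<notin> \<rat>"
  obtains A B where "y = of_rat A + of_rat B * x"
proof -
  have "rat_space.independent {1, x}"
  proof -
    have "rat_space.independent {1 :: 'k}" by simp
    moreover have "x \<notin> rat_space.span {1}"
    proof
      assume "x \<in> rat_space.span {1}"
      then obtain k where "x = rat_scale k 1" by (auto simp: rat_space.span_singleton)
      then show False using assms(2) by (simp add: rat_scale_def)
    qed
    ultimately show ?thesis using rat_space.independent_insertI[of x "{1}"] by (simp add: insert_commute)
  qed
  then obtain T :: "'k set" where T: "{1, x} \<subseteq> T" "rat_space.independent T" "UNIV \<subseteq> rat_space.span T"
    using rat_space.maximal_independent_subset_extend[of "{1, x}" UNIV] by auto
  have "card T = 2"
    using rat_space.basis_card_eq_dim[OF _ T(3,2)] assms(1) unfolding quadratic_field_def by simp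
  moreover have "x \<noteq> 1" using assms(2) by auto
  ultimately have "{1, x} = T" using T(1) by (intro card_subset_eq) (auto intro: card_ge_0_finite)
  then have "y \<in> rat_space.span {1, x}" using T(3) by blast
  then obtain A where "y - rat_scale A 1 \<in> rat_space.span {x}"
    using rat_space.span_breakdown_eq[of y 1 "{x}"] by blast
  then obtain B where "y - rat_scale A 1 = rat_scale B x" by (auto simp: rat_space.span_singleton)
  then have "y = of_rat A + of_rat B * x" by (simp add: rat_scale_def algebra_simps)
  then show thesis by (rule that)
qed

text \<open>Square roots of rationals in one quadratic field: if \<open>v = A + B u\<close>, then
  rationality of \<open>v^2\<close> and irrationality of \<open>u\<close> force
  \<open>A B = 0\<close>.\<close>

lemma product_rational:
  fixes u v :: "'k::field_char_0"
  assumes "quadratic_field TYPE('k)" "u\<^sup>2 \<in> \<rat>" "v\<^sup>2 \<in> \<rat>"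
  shows "u \<in> \<rat> \<or> v \<in> \<rat> \<or> u * v \<in> \<rat>"
proof (cases "u \<in> \<rat>")
  case False
  obtain A B where v: "v = of_rat A + of_rat B * u"
    using quadratic_field_coordinates[OF assms(1) False] .
  obtain p where p: "u\<^sup>2 = of_rat p" using assms(2) by (auto elim: Rats_cases)
  obtain q where q: "v\<^sup>2 = of_rat q" using assms(3) by (auto elim: Rats_cases)
  have "of_rat (A\<^sup>2 + B\<^sup>2 * p - q) + of_rat (2 * A * B) * u = 0"
    unfolding of_rat_hom of_rat_numeral_eq p[symmetric] q[symmetric] v by algebra
  then have "A * B = 0" using linear_independence[OF False] by fastforce
  then show ?thesis
  proof (elim mult_eq_0_iff[THEN iffD1, THEN disjE])
    assume "A = 0"
    then have "u * v = of_rat (B * p)" unfolding v of_rat_mult p[symmetric] by (simp add: power2_eq_square)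
    then show ?thesis by simp
  next
    assume "B = 0"
    then show ?thesis using v by simp
  qed
qed simp

text \<open>Multiplicativity of the norm, obtained by comparing coordinates:
  \<open>A^2 + A B t + B^2 n\<close> is the norm of \<open>A + B x\<close>, and
  \<open>r^2 - r t + n\<close> that of \<open>x - r\<close>.\<close>

lemma norm_square:
  fixes x :: "'k::field_char_0"
  assumes x: "x \<notin> \<rat>" "x\<^sup>2 = of_rat t * x - of_rat n"
    and eq: "(of_rat A + of_rat B * x)\<^sup>2 = (x - of_rat r) * (x - of_rat s)"
  shows "(A\<^sup>2 + A * B * t + B\<^sup>2 * n)\<^sup>2 = (r\<^sup>2 - r * t + n) * (s\<^sup>2 - s * t + n)"
proof -
  have "of_rat (A\<^sup>2 - B\<^sup>2 * n - (r * s - n)) + of_rat (2 * A * B + B\<^sup>2 * t - (t - r - s)) * x = 0"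
    unfolding of_rat_hom of_rat_numeral_eq using x(2) eq by algebra
  from linear_independence[OF x(1) this]
  have "A\<^sup>2 - B\<^sup>2 * n = r * s - n" "2 * A * B + B\<^sup>2 * t = t - r - s" by auto
  then show ?thesis by algebra
qed

lemma minimal_polynomial_nonzero:
  fixes x :: "'k::field_char_0"
  assumes x: "x \<notin> \<rat>" "x\<^sup>2 = of_rat t * x - of_rat n"
  shows "r\<^sup>2 - r * t + n \<noteq> 0"
proof
  assume "r\<^sup>2 - r * t + n = 0"
  then have "of_rat (r\<^sup>2 - r * t + n) = (0 :: 'k)" by simp
  then have "(x - of_rat r) * (x - of_rat (t - r)) = 0"
    unfolding of_rat_hom using x(2) by algebra
  then have "x = of_rat r \<or> x = of_rat (t - r)" by simp
  then show False using x(1) by auto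
qed

text \<open>Supplies the hypotheses of \<open>pairs_1\<close>: the quartic is reduced by
  \<open>x^3 = (t^2 - n) x - t n\<close> and \<open>x^4 = (t^3 - 2 t n) x - (t^2 - n) n\<close>, and
  coordinates are compared.\<close>

lemma conjugate_pair_1:
  fixes x :: "'k::field_char_0"
  assumes x: "x \<notin> \<rat>" "x\<^sup>2 = of_rat t * x - of_rat n"
    and eq: "(of_rat A + of_rat B * x)\<^sup>2 = (x\<^sup>2 - 4) * ((x - 3) * (x + 1))"
  shows "lines_1 t n \<or> conics_1 t n"
proof -
  have "of_rat (A\<^sup>2 - B\<^sup>2 * n - (- (t\<^sup>2 - n) * n + 2 * t * n + 7 * n + 12))
    + of_rat (2 * A * B + B\<^sup>2 * t - ((t^3 - 2 * t * n) - 2 * (t\<^sup>2 - n) - 7 * t + 8)) * x = 0"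
    unfolding of_rat_hom of_rat_numeral_eq using x(2) eq by algebra
  from linear_independence[OF x(1) this] show ?thesis by (intro pairs_1[of A B]) auto
qed

lemma conjugate_pair_3:
  fixes x :: "'k::field_char_0"
  assumes x: "x \<notin> \<rat>" "x\<^sup>2 = of_rat t * x - of_rat n"
    and eq: "(of_rat A + of_rat B * x)\<^sup>2 = ((x - 3) * (x + 1)) * ((x + 3) * (x - 1))"
  shows "lines_3 t n \<or> conics_3 t n"
proof -
  have "of_rat (A\<^sup>2 - B\<^sup>2 * n - (- (t\<^sup>2 - n) * n + 10 * n + 9))
    + of_rat (2 * A * B + B\<^sup>2 * t - ((t^3 - 2 * t * n) - 10 * t)) * x = 0"
    unfolding of_rat_hom of_rat_numeral_eq using x(2) eq by algebra
  from linear_independence[OF x(1) this] show ?thesis by (intro pairs_3[of A B]) auto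
qed

section \<open>Excluding irrational and rational values of x\<close>

lemma no_irrational_point:
  fixes x y1 y2 y3 :: "'k::field_char_0"
  assumes qf: "quadratic_field TYPE('k)" and x: "x \<notin> \<rat>"
    and y1: "y1\<^sup>2 = x\<^sup>2 - 4" and y2: "y2\<^sup>2 = (x - 3) * (x + 1)" and y3: "y3\<^sup>2 = (x + 3) * (x - 1)"
  shows False
proof -
  obtain p t where "x\<^sup>2 = of_rat p + of_rat t * x" using quadratic_field_coordinates[OF qf x] .
  then obtain n where xx: "x\<^sup>2 = of_rat t * x - of_rat n"
    by (metis add.commute diff_minus_eq_add of_rat_minus)
  note coords = quadratic_field_coordinates[OF qf x]
  obtain A1 B1 where c1: "y1 = of_rat A1 + of_rat B1 * x" by (rule coords)
  obtain A2 B2 where c2: "y2 = of_rat A2 + of_rat B2 * x" by (rule coords)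
  obtain A3 B3 where c3: "y3 = of_rat A3 + of_rat B3 * x" by (rule coords)
  obtain A12 B12 where c12: "y1 * y2 = of_rat A12 + of_rat B12 * x" by (rule coords)
  obtain A13 B13 where c13: "y1 * y3 = of_rat A13 + of_rat B13 * x" by (rule coords)
  obtain A23 B23 where c23: "y2 * y3 = of_rat A23 + of_rat B23 * x" by (rule coords)
  have "(A1\<^sup>2 + A1 * B1 * t + B1\<^sup>2 * n)\<^sup>2 = (2\<^sup>2 - 2 * t + n) * ((- 2)\<^sup>2 - (- 2) * t + n)"
    using y1 unfolding c1 by (intro norm_square[OF x xx]) (simp add: of_rat_minus power2_eq_square algebra_simps)
  moreover have "(A2\<^sup>2 + A2 * B2 * t + B2\<^sup>2 * n)\<^sup>2 = (3\<^sup>2 - 3 * t + n) * ((- 1)\<^sup>2 - (- 1) * t + n)"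
    using y2 unfolding c2 by (intro norm_square[OF x xx]) (simp add: of_rat_minus)
  moreover have "(A3\<^sup>2 + A3 * B3 * t + B3\<^sup>2 * n)\<^sup>2 = ((- 3)\<^sup>2 - (- 3) * t + n) * (1\<^sup>2 - 1 * t + n)"
    using y3 unfolding c3 by (intro norm_square[OF x xx]) (simp add: of_rat_minus)
  moreover note nz = minimal_polynomial_nonzero[OF x xx, of 2] minimal_polynomial_nonzero[OF x xx, of "-2"]
    minimal_polynomial_nonzero[OF x xx, of 3] minimal_polynomial_nonzero[OF x xx, of "-3"]
    minimal_polynomial_nonzero[OF x xx, of 1] minimal_polynomial_nonzero[OF x xx, of "-1"]
  ultimately obtain a b c where norms: "a\<^sup>2 = (4 - 2 * t + n) * (4 + 2 * t + n)"
    "b\<^sup>2 = (9 - 3 * t + n) * (1 + t + n)" "c\<^sup>2 = (9 + 3 * t + n) * (1 - t + n)"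
    "a \<noteq> 0" "b \<noteq> 0" "c \<noteq> 0"
    by (simp add: mult.commute) (metis mult_eq_0_iff zero_power2)
  have "lines_1 t n \<or> conics_1 t n"
    by (rule conjugate_pair_1[OF x xx, of A12 B12]) (simp add: power_mult_distrib y1 y2 flip: c12)
  moreover have "lines_1 (- t) n \<or> conics_1 (- t) n"
  \<comment> \<open>Replacing \<open>x\<close> by \<open>- x\<close> carries \<open>y3^2\<close> to
    the form of \<open>y2^2\<close> and negates the trace, so \<open>y1 * y3\<close> falls under
    curve 1.\<close>
  proof (rule conjugate_pair_1)
    show "- x \<notin> \<rat>" using x by simp
    show "(- x)\<^sup>2 = of_rat (- t) * (- x) - of_rat n" using xx by (simp add: of_rat_minus)
    have "(of_rat A13 + of_rat (- B13) * (- x))\<^sup>2 = (y1 * y3)\<^sup>2" by (simp add: of_rat_minus c13)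
    also have "\<dots> = ((- x)\<^sup>2 - 4) * ((- x - 3) * (- x + 1))"
      unfolding power_mult_distrib y1 y3 by (simp add: algebra_simps)
    finally show "(of_rat A13 + of_rat (- B13) * (- x))\<^sup>2 = ((- x)\<^sup>2 - 4) * ((- x - 3) * (- x + 1))" .
  qed
  moreover have "lines_3 t n \<or> conics_3 t n"
    by (rule conjugate_pair_3[OF x xx, of A23 B23]) (simp add: power_mult_distrib y2 y3 flip: c23)
  ultimately have tn: "t = 0" "n = 7/2" using trace_norm_unique[OF norms] by auto
  \<comment> \<open>Now \<open>x^2 = - 7/2\<close> and \<open>y1^2 = - 15/2\<close>. Either
    coordinate of \<open>y1\<close> vanishes, so \<open>105\<close> or \<open>- 15/2\<close> would
    be a rational square.\<close>
  have "of_rat (A1\<^sup>2 - 7/2 * B1\<^sup>2 + 15/2) + of_rat (2 * A1 * B1) * x = 0"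
  proof -
    have 7: "of_rat (7/2) = (7/2 :: 'k)" "of_rat (15/2) = (15/2 :: 'k)" by (simp_all add: of_rat_divide)
    have "x\<^sup>2 = - 7/2" using xx unfolding tn 7 by simp
    then show ?thesis using y1 unfolding c1 of_rat_hom of_rat_numeral_eq 7
      by (simp add: power2_sum power_mult_distrib algebra_simps)
  qed
  from linear_independence[OF x this] have e: "A1\<^sup>2 = 7/2 * B1\<^sup>2 - 15/2" and "A1 = 0 \<or> B1 = 0" by auto
  then show False
  proof (elim disjE)
    assume "A1 = 0"
    then have "(7 * B1)\<^sup>2 = of_int 105" using e by (simp add: power_mult_distrib)
    from rat_square_not_between[OF this, of 10] show False by simp
  next
    assume "B1 = 0"
    then show False using e zero_le_power2[of A1] by simp
  qed
qed

lemma no_rational_point: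
  fixes y1 y2 y3 :: "'k::field_char_0"
  assumes qf: "quadratic_field TYPE('k)" and x: "x \<in> \<rat>" "x \<noteq> 0"
    and nz: "y1 \<noteq> 0" "y2 \<noteq> 0" "y3 \<noteq> 0"
    and y1: "y1\<^sup>2 = x\<^sup>2 - 4" and y2: "y2\<^sup>2 = (x - 3) * (x + 1)" and y3: "y3\<^sup>2 = (x + 3) * (x - 1)"
  shows False
proof -
  obtain r where r: "x = of_rat r" using x(1) by (auto elim: Rats_cases)
  have sq: "y1\<^sup>2 = of_rat (r\<^sup>2 - 4)" "y2\<^sup>2 = of_rat ((r - 3) * (r + 1))" "y3\<^sup>2 = of_rat ((r + 3) * (r - 1))"
    unfolding y1 y2 y3 r by (simp_all add: of_rat_hom)
  \<comment> \<open>Both \<open>x = 1/2\<close> and \<open>x = - 1/2\<close> end here, with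
    \<open>v\<close> being \<open>y3\<close> or \<open>y2\<close>. Neither square is that of a
    rational, and a rational \<open>y1 * v\<close> would make \<open>105/16\<close> a
    square.\<close>
  have no_half: False if v: "v\<^sup>2 = of_rat (- 7/4)" and u: "y1\<^sup>2 = of_rat (- 15/4)" for v :: 'k
  proof -
    from product_rational[OF qf, of y1 v] u v
    consider w where "y1 = of_rat w" | w where "v = of_rat w" | w where "y1 * v = of_rat w"
      by (auto elim!: Rats_cases)
    then show False
    proof cases
      case 1
      then have "w\<^sup>2 = - 15/4" using u by (simp flip: of_rat_power)
      then show False using zero_le_power2[of w] by simp
    next
      case 2
      then have "w\<^sup>2 = - 7/4" using v by (simp flip: of_rat_power)
      then show False using zero_le_power2[of w] by simp
    next
      case 3
      then have "of_rat (w\<^sup>2) = (of_rat (- 15/4 * (- 7/4)) :: 'k)"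
        unfolding of_rat_power of_rat_mult u[symmetric] v[symmetric] by (simp flip: power_mult_distrib)
      then have "w\<^sup>2 = 105/16" unfolding of_rat_eq_iff by simp
      then have "(4 * w)\<^sup>2 = of_int 105" by (simp add: power_mult_distrib)
      from rat_square_not_between[OF this, of 10] show False by simp
    qed
  qed
  have "y1\<^sup>2 \<in> \<rat>" "y2\<^sup>2 \<in> \<rat>" "y3\<^sup>2 \<in> \<rat>" unfolding sq by simp_all
  \<comment> \<open>Two of the three \<open>y\<close>s are both rational or both irrational; in the
    latter case \<open>product_rational\<close> makes their product rational.\<close>
  then have "y1 * y2 \<in> \<rat> \<or> y1 * y3 \<in> \<rat> \<or> y2 * y3 \<in> \<rat>"
    using product_rational[OF qf, of y1 y2] product_rational[OF qf, of y1 y3]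
      product_rational[OF qf, of y2 y3] by (metis Rats_mult)
  then consider w where "y1 * y2 = of_rat w" | w where "y1 * y3 = of_rat w" | w where "y2 * y3 = of_rat w"
    by (auto elim!: Rats_cases)
  then show False
  proof cases
    case 1
    have "of_rat (w\<^sup>2) = (of_rat ((r\<^sup>2 - 4) * ((r - 3) * (r + 1))) :: 'k)"
      unfolding of_rat_power of_rat_mult[of "r\<^sup>2 - 4"] sq[symmetric] 1[symmetric] by (rule power_mult_distrib)
    then have "w = 0 \<or> r = 1/2" by (intro rational_points_1) (simp only: of_rat_eq_iff)
    moreover have "w \<noteq> 0" using 1 nz by auto
    ultimately have r: "r = 1/2" by blast
    have "y1\<^sup>2 = of_rat (- 15/4)" "y3\<^sup>2 = of_rat (- 7/4)"
      unfolding sq r by (simp_all add: power2_eq_square)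
    then show False using no_half by blast
  next
    case 2
    have "of_rat (w\<^sup>2) = (of_rat ((r\<^sup>2 - 4) * ((r + 3) * (r - 1))) :: 'k)"
      unfolding of_rat_power of_rat_mult[of "r\<^sup>2 - 4"] sq[symmetric] 2[symmetric] by (rule power_mult_distrib)
    then have "w\<^sup>2 = ((- r)\<^sup>2 - 4) * ((- r - 3) * (- r + 1))"
      by (simp add: of_rat_eq_iff algebra_simps)
    then have "w = 0 \<or> - r = 1/2" by (rule rational_points_1)
    moreover have "w \<noteq> 0" using 2 nz by auto
    ultimately have "r = - 1/2" by simp
    then show False using no_half[of y2] sq by (simp add: power2_eq_square)
  next
    case 3
    have "of_rat (w\<^sup>2) = (of_rat (((r - 3) * (r + 1)) * ((r + 3) * (r - 1))) :: 'k)"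
      unfolding of_rat_power of_rat_mult[of "(r - 3) * (r + 1)"] sq[symmetric] 3[symmetric] by (rule power_mult_distrib)
    then have "w = 0 \<or> r = 0" by (intro rational_points_3) (simp only: of_rat_eq_iff)
    then show False using 3 nz x(2) r by auto
  qed
qed

section \<open>From the graph to the curve\<close>

lemma G5_embedding:
  assumes "contains_subgraph_iso (preperiodic_graph f) G5"
  obtains h where "inj h" "\<And>u v. (u, v) \<in> parcs G5 \<Longrightarrow> h v = f (h u)"
proof -
  obtain H where sub: "subgraph H (with_proj (preperiodic_graph f))" and iso: "digraph_iso (with_proj G5) H"
    using assms unfolding contains_subgraph_iso_def by blast
  from iso obtain i where i: "pre_digraph.digraph_isomorphism (with_proj G5) i" and H: "H = app_iso i (with_proj G5)"
    unfolding digraph_iso_def by blast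
  \<comment> \<open>An isomorphism carries its own tail and head maps; compatibility with the
    ambient graph fixes them as \<open>fst\<close> and \<open>snd\<close>, so every image arc has
    the form \<open>(x, f x)\<close>.\<close>
  have arcs: "arcs H \<subseteq> parcs (preperiodic_graph f)" and ends: "tail H = fst" "head H = snd"
    using sub by (auto simp: subgraph_def compatible_def)
  have "pverts G5 = UNIV"
    using G5_vertex.exhaust unfolding G5_def by auto
  then have "inj (iso_verts i)" using i unfolding pre_digraph.digraph_isomorphism_def by simp
  moreover have "iso_verts i v = f (iso_verts i u)" if e: "(u, v) \<in> parcs G5" for u v
  proof -
    have "iso_verts i u = iso_tail i (iso_arcs i (u, v))" "iso_verts i v = iso_head i (iso_arcs i (u, v))"
      using i e unfolding pre_digraph.digraph_isomorphism_def by fastforce+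
    moreover have "iso_tail i = fst" "iso_head i = snd"
      using ends H by (simp_all add: tail_app_iso head_app_iso)
    moreover have "iso_arcs i (u, v) \<in> parcs (preperiodic_graph f)"
      using arcs H e by (auto simp: arcs_app_iso)
    ultimately show ?thesis by (auto simp: preperiodic_graph_def)
  qed
  ultimately show thesis by (rule that)
qed

theorem theorem5p13:
  fixes c :: "'k::field_char_0"
  assumes "quadratic_field TYPE('k)"
  shows "\<not> contains_subgraph_iso (preperiodic_graph (quad_map c)) G5"
proof
  assume "contains_subgraph_iso (preperiodic_graph (quad_map c)) G5"
  then obtain h where inj: "inj h" and h: "\<And>u v. (u, v) \<in> parcs G5 \<Longrightarrow> h v = quad_map c (h u)"
    using G5_embedding by blast
  have edges: "h V_q = (h V_p)\<^sup>2 + c" "h V_p = (h V_q)\<^sup>2 + c" "h V_a = (h V_a)\<^sup>2 + c" "h V_a' = (h V_a')\<^sup>2 + c"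
    "h V_a = (h V_b)\<^sup>2 + c" "h V_a' = (h V_b')\<^sup>2 + c"
    "h V_b = (h V_s)\<^sup>2 + c" "h V_b = (h V_sbar)\<^sup>2 + c" "h V_b' = (h V_r)\<^sup>2 + c" "h V_b' = (h V_rbar)\<^sup>2 + c"
    by (rule h[unfolded quad_map_def], simp add: G5_def)+
  have distinct: "h u \<noteq> h v" if "u \<noteq> v" for u v using inj that by (simp add: inj_eq)
  \<comment> \<open>Subtracting the edge equations pairwise yields factored differences, and
    injectivity of \<open>h\<close> cancels one factor each time.\<close>
  have "(h V_p - h V_q) * (h V_p + h V_q + 1) = 0" using edges(1,2) by algebra
  then have pq: "h V_p + h V_q + 1 = 0" using distinct[of V_p V_q] by simp
  have "(h V_a - h V_a') * (h V_a + h V_a' - 1) = 0" using edges(3,4) by algebra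
  then have aa: "h V_a + h V_a' - 1 = 0" using distinct[of V_a V_a'] by simp
  have "(h V_b - h V_a) * (h V_b + h V_a) = 0" using edges(3,5) by algebra
  then have b: "h V_b + h V_a = 0" using distinct[of V_b V_a] by simp
  have "(h V_b' - h V_a') * (h V_b' + h V_a') = 0" using edges(4,6) by algebra
  then have b': "h V_b' + h V_a' = 0" using distinct[of V_b' V_a'] by simp
  \<comment> \<open>The second preimages enter only here: \<open>s\<close> and \<open>sbar\<close>
    are distinct with equal squares, so \<open>s\<close> is nonzero, and likewise
    \<open>r\<close>.\<close>
  have "(h V_s)\<^sup>2 = (h V_sbar)\<^sup>2" "(h V_r)\<^sup>2 = (h V_rbar)\<^sup>2" using edges(7-10) by algebra+
  then have nz: "h V_s \<noteq> 0" "h V_r \<noteq> 0" using distinct[of V_s V_sbar] distinct[of V_r V_rbar] by auto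
  define x where "x = h V_a - h V_a'"
  have "x \<noteq> 0" "h V_p - h V_q \<noteq> 0" using distinct[of V_a V_a'] distinct[of V_p V_q] x_def by auto
  \<comment> \<open>As \<open>4 c = 1 - x^2\<close>, the discriminant \<open>- 3 - 4 c\<close> of
    the 2-cycle is \<open>x^2 - 4\<close>. The other two squares are \<open>- 4 a - 4 c\<close> and
    \<open>- 4 a' - 4 c\<close> with \<open>a = (1 + x) / 2\<close> and
    \<open>a' = (1 - x) / 2\<close>.\<close>
  moreover have "(h V_p - h V_q)\<^sup>2 = x\<^sup>2 - 4" using edges(1-4) pq aa unfolding x_def by algebra
  moreover have "(2 * h V_s)\<^sup>2 = (x - 3) * (x + 1)" using edges(3,7) b aa unfolding x_def by algebra
  moreover have "(2 * h V_r)\<^sup>2 = (x + 3) * (x - 1)" using edges(4,9) b' aa unfolding x_def by algebra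
  ultimately show False
    using no_irrational_point[OF assms, of x] no_rational_point[OF assms, of x "h V_p - h V_q" "2 * h V_s" "2 * h V_r"] nz
    by (metis mult_eq_0_iff zero_neq_numeral)
qed

end
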